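(* Let $G$ be a connected graph with $n > 3$ vertices such that $\alpha(G)=2$. Then $G$ contains a swap set and, furthermore, $DD_{\mathrm{m}}(G) \leq 2$.
   Context: Graphs are finite, simple and undirected; $\alpha(G)$ is the independence number. Swap number: a dominating set $D$ of a graph $G$ is a swap set if there is a dominating set $D'$ of $G$ with $D\cap D'=\emptyset$, $|D|=|D'|$, such that $G$ contains a perfect matching between $D$ and $D'$ (a bijection $f:D\to D'$ with $x f(x)\in E(G)$ for all $x\in D$). $DD_{\mathrm{m}}(G)$ is the minimum cardinality of a swap set of $G$, and $DD_{\mathrm{m}}(G)=\infty$ if none exists. *)

theory Defs
  imports "Graph_Theory.Digraph_Component" "HOL-Library.Extended_Nat"
begin

text \<open>
  A finite simple undirected graph is a \<open>graph\<close> in the sense of Graph\_Theory: a finite,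
  loop-free, symmetric digraph without parallel arcs, each edge being a pair of opposite arcs.
  Note that the library calls the adjacency relation \<open>u \<rightarrow>\<^bsub>G\<^esub> v\<close> \<^emph>\<open>dominates\<close>;
  \<open>dominating_set\<close> below is domination in the usual, closed-neighbourhood sense.
\<close>

definition independent_set :: "('a, 'b) pre_digraph \<Rightarrow> 'a set \<Rightarrow> bool" where
  "independent_set G S \<longleftrightarrow> S \<subseteq> verts G \<and> (\<forall>u\<in>S. \<forall>v\<in>S. \<not> u \<rightarrow>\<^bsub>G\<^esub> v)"

definition independence_number :: "('a, 'b) pre_digraph \<Rightarrow> nat" where
  "independence_number G = Max {card S | S. independent_set G S}"

definition dominating_set :: "('a, 'b) pre_digraph \<Rightarrow> 'a set \<Rightarrow> bool" where
  "dominating_set G D \<longleftrightarrow>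
     D \<subseteq> verts G \<and> (\<forall>v \<in> verts G - D. \<exists>u\<in>D. u \<rightarrow>\<^bsub>G\<^esub> v)"

definition perfect_matching_between :: "('a, 'b) pre_digraph \<Rightarrow> 'a set \<Rightarrow> 'a set \<Rightarrow> bool" where
  "perfect_matching_between G D D' \<longleftrightarrow>
     (\<exists>f. bij_betw f D D' \<and> (\<forall>x\<in>D. x \<rightarrow>\<^bsub>G\<^esub> f x))"

definition swap_set :: "('a, 'b) pre_digraph \<Rightarrow> 'a set \<Rightarrow> bool" where
  "swap_set G D \<longleftrightarrow> dominating_set G D \<and>
     (\<exists>D'. dominating_set G D' \<and> D \<inter> D' = {} \<and> card D = card D' \<and>
           perfect_matching_between G D D')"

text \<open>The infimum of the empty set in \<^typ>\<open>enat\<close> is \<open>\<infinity>\<close>.\<close>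

definition swap_number :: "('a, 'b) pre_digraph \<Rightarrow> enat" where
  "swap_number G = Inf {enat (card D) | D. swap_set G D}"

lemma swap_number_eq_infinity_iff: "swap_number G = \<infinity> \<longleftrightarrow> (\<nexists>D. swap_set G D)"
proof -
  have "swap_number G \<noteq> \<infinity>" if "swap_set G D" for D
  proof -
    have "swap_number G \<le> enat (card D)"
      unfolding swap_number_def using that by (intro Inf_lower) auto
    then show ?thesis using enat_ile by fastforce
  qed
  moreover have "swap_number G = \<infinity>" if "\<nexists>D. swap_set G D"
    using that by (simp add: swap_number_def Inf_enat_def)
  ultimately show ?thesis by blast
qed

end

theory Submission
  imports Defs
begin

text \<open>
  Every non-adjacent pair of vertices is a maximum independent set and hence dominating.  If there
  are two disjoint non-adjacent pairs, each vertex of one has a neighbour in the other, and a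
  bipartite graph on \<open>2 + 2\<close> vertices without isolated vertices has a perfect matching.
  Otherwise the edges of the complement pairwise intersect; they do not form a triangle, so they
  form a star with some centre \<open>a\<close>.  Then all vertices but \<open>a\<close> form a clique,
  and for a neighbour \<open>c\<close> of \<open>a\<close> and any two further vertices \<open>x\<close>, \<open>y\<close>
  the sets \<open>{a, x}\<close> and \<open>{c, y}\<close> are dominating and matched.
\<close>

lemma swap_set_doubletonI:
  assumes "dominating_set G {a, b}" "dominating_set G {c, d}"
    and "a \<noteq> b" "c \<noteq> d" "{a, b} \<inter> {c, d} = {}"
    and "a \<rightarrow>\<^bsub>G\<^esub> c" "b \<rightarrow>\<^bsub>G\<^esub> d"
  shows "swap_set G {a, b}"
proof -
  let ?f = "\<lambda>x. if x = a then c else d"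
  have "bij_betw ?f {a, b} {c, d}"
    using assms(3-5) by (auto simp: bij_betw_def inj_on_def)
  moreover have "\<forall>x\<in>{a, b}. x \<rightarrow>\<^bsub>G\<^esub> ?f x"
    using assms(3,6,7) by auto
  ultimately have "perfect_matching_between G {a, b} {c, d}"
    unfolding perfect_matching_between_def by blast
  moreover have "card {a, b} = card {c, d}"
    using assms(3,4) by simp
  ultimately show ?thesis
    using assms(1,2,5) unfolding swap_set_def by blast
qed

lemma swap_number_le:
  assumes "swap_set G D"
  shows "swap_number G \<le> enat (card D)"
  unfolding swap_number_def using assms by (intro Inf_lower) auto

context graph
begin

lemma adj_sym: "u \<rightarrow> v \<Longrightarrow> v \<rightarrow> u"
  by (rule arcs_ends_symmetric[OF sym_arcs])

text \<open>\<open>Max\<close> is meaningful only on a finite nonempty set; this supplies finiteness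
  for both bounds on \<open>independence_number\<close>.\<close>

lemma finite_card_independent_sets: "finite {card S | S. independent_set G S}"
proof -
  have "{card S | S. independent_set G S} \<subseteq> card ` Pow (verts G)"
    by (auto simp: independent_set_def)
  then show ?thesis
    by (rule finite_subset) simp
qed

lemma card_independent_set_le:
  "independent_set G S \<Longrightarrow> card S \<le> independence_number G"
  unfolding independence_number_def by (rule Max_ge[OF finite_card_independent_sets]) auto

lemma independence_number_attained:
  obtains S where "independent_set G S" "card S = independence_number G"
proof -
  have "independent_set G {}"
    by (simp add: independent_set_def)
  then have "{card S | S. independent_set G S} \<noteq> {}"
    by blast
  from Max_in[OF finite_card_independent_sets this] show ?thesis
    using that unfolding independence_number_def by auto
qed

text \<open>A vertex without a neighbour in \<open>S\<close> could be added to \<open>S\<close>,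
  giving a larger independent set.\<close>

lemma dominating_set_maximum_independent:
  assumes "independent_set G S" "card S = independence_number G"
  shows "dominating_set G S"
proof -
  have "\<exists>u\<in>S. u \<rightarrow> v" if v: "v \<in> verts G - S" for v
  proof (rule ccontr)
    assume "\<not> (\<exists>u\<in>S. u \<rightarrow> v)"
    then have "independent_set G (insert v S)"
      using assms(1) v adj_sym adj_not_same unfolding independent_set_def by blast
    then have "card (insert v S) \<le> independence_number G"
      by (rule card_independent_set_le)
    moreover have "finite S"
      using assms(1) finite_subset finite_verts unfolding independent_set_def by blast
    ultimately show False
      using v assms(2) by simp
  qed
  then show ?thesis
    using assms(1) unfolding dominating_set_def independent_set_def by blast
qed

text \<open>The first arc of a walk from \<open>a\<close> to \<open>b\<close> leads to the
  neighbour.\<close>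

lemma connected_obtains_neighbour:
  assumes "connected G" "a \<in> verts G" "b \<in> verts G" "a \<noteq> b"
  obtains c where "a \<rightarrow> c"
proof -
  have "strongly_connected G"
    using assms(1) sym_arcs by (simp add: symmetric_connected_imp_strongly_connected)
  then have "a \<rightarrow>\<^sup>* b"
    using assms(2,3) by (auto simp: strongly_connected_def)
  then show ?thesis
    using assms(4) that by (cases rule: converse_reachable_cases) auto
qed

lemma swap_set_of_disjoint_doubletons:
  assumes "dominating_set G {a, b}" "dominating_set G {c, d}"
    and "a \<noteq> b" "c \<noteq> d" "{a, b} \<inter> {c, d} = {}"
  shows "swap_set G {a, b}"
proof -
  have "c \<rightarrow> a \<or> d \<rightarrow> a" "c \<rightarrow> b \<or> d \<rightarrow> b"
       "a \<rightarrow> c \<or> b \<rightarrow> c" "a \<rightarrow> d \<or> b \<rightarrow> d"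
    using assms unfolding dominating_set_def by auto
  \<comment> \<open>If \<open>a\<close> and \<open>c\<close> are not adjacent, dominating
    \<open>a\<close> forces the edge to \<open>d\<close> and dominating \<open>c\<close> forces the
    edge to \<open>b\<close>; the case of \<open>b\<close> and \<open>d\<close> is alike. So if one
    pairing fails, the other works.\<close>
  then consider "a \<rightarrow> c" "b \<rightarrow> d" | "a \<rightarrow> d" "b \<rightarrow> c"
    using adj_sym by blast
  then show ?thesis
  proof cases
    case 1
    then show ?thesis
      using assms by (intro swap_set_doubletonI[of G a b c d])
  next
    case 2
    then show ?thesis
      using assms by (intro swap_set_doubletonI[of G a b d c]) (auto simp: insert_commute)
  qed
qed

text \<open>Within the clique \<open>x\<close> dominates everything but \<open>a\<close>, while
  \<open>c\<close> dominates \<open>a\<close> as well; \<open>y\<close> serves as the partner of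
  \<open>x\<close>.\<close>

lemma swap_set_if_nonedges_form_star:
  assumes "connected G" "card (verts G) > 3" "a \<in> verts G"
    and clique: "\<And>u v. u \<in> verts G \<Longrightarrow> v \<in> verts G \<Longrightarrow> u \<noteq> v \<Longrightarrow> u \<noteq> a \<Longrightarrow> v \<noteq> a \<Longrightarrow> u \<rightarrow> v"
  obtains x where "swap_set G {a, x}" "x \<noteq> a"
proof -
  have "verts G \<noteq> {a}"
    using assms(2) by auto
  then obtain b where "b \<in> verts G" "a \<noteq> b"
    using assms(3) by blast
  then obtain c where c: "a \<rightarrow> c"
    using connected_obtains_neighbour[OF assms(1,3)] by blast
  have c': "c \<in> verts G" "c \<noteq> a" "c \<rightarrow> a"
    using c adj_in_verts adj_not_same adj_sym by blast+
  \<comment> \<open>Here the bound on the number of vertices leaves room for both \<open>x\<close>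
    and \<open>y\<close>.\<close>
  have "2 \<le> card (verts G - {a, c})"
    using assms(2,3) c' by (simp add: card_Diff_subset)
  then obtain T where "T \<subseteq> verts G - {a, c}" "card T = 2"
    by (meson obtain_subset_with_card_n)
  then obtain x y where xy: "x \<in> verts G - {a, c}" "y \<in> verts G - {a, c}" "x \<noteq> y"
    by (auto simp: card_2_iff)
  have "dominating_set G {a, x}"
    using assms(3) xy clique unfolding dominating_set_def by auto
  moreover have "dominating_set G {c, y}"
    using xy c' clique unfolding dominating_set_def by fast
  moreover have "x \<rightarrow> y"
    using xy clique by auto
  ultimately have "swap_set G {a, x}"
    using xy c c' by (intro swap_set_doubletonI[of G a x c y]) auto
  then show ?thesis
    using xy that by blast
qed

end

theorem theorem32:
  fixes G :: "('a, 'b) pre_digraph"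
  assumes "graph G"
    and "connected G"
    and "card (verts G) > 3"
    and "independence_number G = 2"
  shows "(\<exists>D. swap_set G D) \<and> swap_number G \<le> 2"
proof -
  interpret graph G by fact
  \<comment> \<open>\<open>N\<close> is adjacency in the complement graph.\<close>
  define N where "N u v \<longleftrightarrow> u \<in> verts G \<and> v \<in> verts G \<and> u \<noteq> v \<and> \<not> u \<rightarrow>\<^bsub>G\<^esub> v" for u v
  have N_sym: "N v u" if "N u v" for u v
    using that adj_sym unfolding N_def by blast
  have N_dom: "dominating_set G {u, v}" if "N u v" for u v
  proof (rule dominating_set_maximum_independent)
    show "independent_set G {u, v}"
      using that adj_sym adj_not_same unfolding independent_set_def N_def by blast
    show "card {u, v} = independence_number G"
      using that assms(4) unfolding N_def by simp
  qed
  have no_triangle: False if "N u v" "N v w" "N u w" for u v w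
  proof -
    have "independent_set G {u, v, w}"
      using that adj_sym adj_not_same unfolding independent_set_def N_def by blast
    from card_independent_set_le[OF this] show False
      using that assms(4) unfolding N_def by simp
  qed
  obtain S where "independent_set G S" "card S = 2"
    using independence_number_attained assms(4) by metis
  then obtain a b where ab: "N a b"
    by (auto simp: card_2_iff independent_set_def N_def)
  have "\<exists>u v. u \<noteq> v \<and> swap_set G {u, v}"
  proof (cases "\<exists>p q r s. N p q \<and> N r s \<and> {p, q} \<inter> {r, s} = {}")
    case True
    then obtain p q r s where pqrs: "N p q" "N r s" "{p, q} \<inter> {r, s} = {}"
      by blast
    then have "swap_set G {p, q}"
      by (intro swap_set_of_disjoint_doubletons[of p q r s] N_dom) (auto simp: N_def)
    then show ?thesis
      using pqrs(1) unfolding N_def by blast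
  next
    case False
    then have meet: "p \<in> {r, s} \<or> q \<in> {r, s}" if "N p q" "N r s" for p q r s
      using that by blast
    have star: ?thesis if z: "z \<in> verts G" "\<And>u v. N u v \<Longrightarrow> u = z \<or> v = z" for z
      using swap_set_if_nonedges_form_star[OF assms(2,3) z(1)] z(2) unfolding N_def by metis
    show ?thesis
    \<comment> \<open>A centre lies on every edge of the complement, in particular on
      \<open>ab\<close>, so only \<open>a\<close> and \<open>b\<close> are candidates.\<close>
    proof (cases "\<forall>u v. N u v \<longrightarrow> u = a \<or> v = a")
      case True
      then show ?thesis
        using star[of a] ab unfolding N_def by blast
    next
      case False
      \<comment> \<open>A complement edge avoiding \<open>a\<close> must meet \<open>ab\<close> in
        \<open>b\<close>; \<open>y\<close> is its other end.\<close>
      then obtain y where y: "N b y" "y \<noteq> a"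
        using meet[OF ab] N_sym by blast
      have "u = b \<or> v = b" if uv: "N u v" for u v
      proof (rule ccontr)
        assume "\<not> (u = b \<or> v = b)"
        then obtain x where x: "N a x" "x \<noteq> b"
          using uv meet[OF ab] N_sym by blast
        \<comment> \<open>The complement edges \<open>ax\<close> and \<open>by\<close> must meet,
          and only \<open>x\<close> and \<open>y\<close> can coincide; then \<open>a\<close>,
          \<open>b\<close>, \<open>y\<close> form a triangle in the complement.\<close>
        have "x = y"
          using meet[OF x(1) y(1)] x(2) y(2) ab unfolding N_def by blast
        then show False
          using no_triangle[OF ab y(1)] x(1) by blast
      qed
      then show ?thesis
        using star[of b] ab unfolding N_def by blast
    qed
  qed
  then obtain u v where uv: "u \<noteq> v" "swap_set G {u, v}"
    by blast
  from swap_number_le[OF uv(2)] have "swap_number G \<le> 2"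
    using uv(1) by (simp add: numeral_eq_enat numeral_2_eq_2)
  then show ?thesis
    using uv(2) by blast
qed

end
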